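(* Let $g$, $v$, $w_\eta$ satisfy the hypotheses listed in the context. Let $(\rho_j^0)_{j\in\mathbb{Z}}$ be a given initial datum with values in $I=[0,\rho_{\max}]$, and set $\rho_M=\sup_{j\in\mathbb{Z}}\rho_j^0$, $\rho_m=\inf_{j\in\mathbb{Z}}\rho_j^0$. Let $\rho_j^n$ be constructed by the Godunov type scheme $$\rho_j^{n+1}=\rho_j^n-\lambda\big(V_{j+\frac12}^n g(\rho_j^n)-V_{j-\frac12}^n g(\rho_{j-1}^n)\big),\qquad V_{j+\frac12}^n=\sum_{k=0}^{N-1}\gamma_k\,v(\rho_{j+k+1}^n).$$ If the CFL condition $$\lambda\le\frac{1}{\gamma_0\|v'\|\|g\|+\|v\|\|g'\|}$$ holds, then $$\rho_m\le\rho_j^n\le\rho_M\qquad\forall j\in\mathbb{Z},\ n\in\mathbb{N}.$$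
   Context: Hypotheses on the data. $\mathbb{R}^+=[0,\infty)$, $\rho_{\max}>0$, $I=[0,\rho_{\max}]$; $g\in C^1(I;\mathbb{R}^+)$ with $g'\ge 0$; $v\in C^2(I;\mathbb{R}^+)$ with $v'\le 0$; for every $\eta>0$, $w_\eta\in C^1([0,\eta];\mathbb{R}^+)$ with $w_\eta'\le 0$ and $\int_0^\eta w_\eta(x)\,dx=W_0$, where the constant $W_0$ does not depend on $\eta$, and $\lim_{\eta\to\infty}w_\eta(0)=0$. Discretization. $\eta>0$ is fixed; $h>0$ is a space step with $\eta=Nh$ for some integer $N\ge 1$; $\tau>0$ is the time step and $\lambda=\tau/h$. The weights are $\gamma_k=\int_{kh}^{(k+1)h}w_\eta(y)\,dy$, $k=0,\dots,N-1$. $\|\cdot\|$ denotes the $L^\infty$ norm on $I$ for $g,g',v,v'$.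
   Formalization: The formal theorem additionally assumes W_0 ≤ 1; for every W_0 > 1 the claim as stated fails (v=1, g(x)=x, w_η=W_0/η, ρ_max=1, λ=1, datum 1 for j<0 and 0 for j≥0 gives ρ_0^1=W_0>ρ_M). *)

theory Defs
  imports "HOL-Analysis.Analysis" "HOL-Probability.Essential_Supremum"
begin

text \<open>The derivative relative to S: at the end points of a compact interval it is one-sided,
  so values of f outside S play no role.\<close>

definition deriv_on :: "real set \<Rightarrow> (real \<Rightarrow> real) \<Rightarrow> real \<Rightarrow> real" where
  "deriv_on S f x = vector_derivative f (at x within S)"

primrec C_on :: "nat \<Rightarrow> real set \<Rightarrow> (real \<Rightarrow> real) \<Rightarrow> bool" where
  "C_on 0 S f = continuous_on S f"
| "C_on (Suc k) S f = (f differentiable_on S \<and> C_on k S (deriv_on S f))"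

text \<open>Extended-real valued, so that the CFL bound 1 / (...) is infinite, not 0, when its
  denominator vanishes.\<close>

definition Linf_norm :: "real set \<Rightarrow> (real \<Rightarrow> real) \<Rightarrow> ereal" where
  "Linf_norm S f = esssup (lebesgue_on S) (\<lambda>x. ereal \<bar>f x\<bar>)"

definition weight :: "(real \<Rightarrow> real) \<Rightarrow> real \<Rightarrow> nat \<Rightarrow> real" where
  "weight w h k = integral {real k * h .. (real k + 1) * h} w"

text \<open>The value of \<open>velocity\<close> at j is the interface velocity \<open>V\<close> at \<open>j + 1/2\<close>.\<close>

definition velocity ::
  "nat \<Rightarrow> (nat \<Rightarrow> real) \<Rightarrow> (real \<Rightarrow> real) \<Rightarrow> (int \<Rightarrow> real) \<Rightarrow> int \<Rightarrow> real" where
  "velocity N \<gamma> v r j = (\<Sum>k = 0..<N. \<gamma> k * v (r (j + int k + 1)))"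

primrec godunov ::
  "real \<Rightarrow> nat \<Rightarrow> (nat \<Rightarrow> real) \<Rightarrow> (real \<Rightarrow> real) \<Rightarrow> (real \<Rightarrow> real) \<Rightarrow> (int \<Rightarrow> real)
    \<Rightarrow> nat \<Rightarrow> int \<Rightarrow> real" where
  "godunov lam N \<gamma> v g r0 0 = r0"
| "godunov lam N \<gamma> v g r0 (Suc n) =
    (let r = godunov lam N \<gamma> v g r0 n; V = velocity N \<gamma> v r
     in (\<lambda>j. r j - lam * (V j * g (r j) - V (j - 1) * g (r (j - 1)))))"

end

theory Submission
  imports Defs
begin

text \<open>Writing \<open>V j\<close> for the interface velocity at \<open>j + 1/2\<close>, summation by parts with the
  decreasing weights \<open>\<gamma>\<close> bounds \<open>V (j - 1) - V j\<close> between \<open>\<gamma> 0 * (v (r j) - v m)\<close> and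
  \<open>\<gamma> 0 * (v (r j) - v M)\<close> whenever \<open>r\<close> takes values in \<open>[m, M]\<close>.  As \<open>V \<ge> 0\<close> and \<open>g\<close> is
  increasing, replacing \<open>g (r (j - 1))\<close> by \<open>g M\<close> (or \<open>g m\<close>) shows that one step moves
  \<open>r j\<close> towards \<open>M\<close> (or \<open>m\<close>) by at most
  \<open>lam * (\<gamma> 0 * \<parallel>v'\<parallel> * \<parallel>g\<parallel> + \<parallel>v\<parallel> * \<parallel>g'\<parallel>)\<close> times the distance to it, which the CFL
  condition keeps below that distance.\<close>

section \<open>Mean value estimates for one-sided derivatives on a compact interval\<close>

lemma mvt_deriv_on:
  assumes "C_on (Suc k) {a..b} f" "x \<in> {a..b}" "y \<in> {a..b}" "x < y"
  obtains z where "z \<in> {x<..<y}" "f y - f x = (y - x) * deriv_on {a..b} f z"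
proof -
  have der: "(f has_derivative (\<lambda>t. t *\<^sub>R deriv_on {a..b} f z)) (at z within {x..y})"
    if "x \<le> z" "z \<le> y" for z
  proof -
    have "f differentiable (at z within {a..b})"
      using assms that by (auto simp: differentiable_on_def)
    then have "(f has_derivative (\<lambda>t. t *\<^sub>R deriv_on {a..b} f z)) (at z within {a..b})"
      unfolding deriv_on_def
      by (simp only: vector_derivative_works has_vector_derivative_def)
    then show ?thesis
      \<comment> \<open>A derivative relative to \<open>{a..b}\<close> stays one relative to
        \<open>{x..y}\<close>, so the mean value theorem applies there even when \<open>x\<close> or
        \<open>y\<close> is an end point.\<close>
      by (rule has_derivative_subset) (use assms in auto)
  qed
  obtain z where "z \<in> {x<..<y}" "f y - f x = (y - x) *\<^sub>R deriv_on {a..b} f z"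
    using mvt_simple[OF \<open>x < y\<close> der] by auto
  then show thesis
    by (intro that) auto
qed

lemma deriv_on_nonneg_imp_mono_on:
  assumes "C_on (Suc k) {a..b} f" "\<forall>x\<in>{a..b}. deriv_on {a..b} f x \<ge> 0"
  shows "mono_on {a..b} f"
proof (rule mono_onI)
  fix x y assume xy: "x \<in> {a..b}" "y \<in> {a..b}" "x \<le> y"
  show "f x \<le> f y"
  proof (cases "x = y")
    case False
    then obtain z where z: "z \<in> {x<..<y}" "f y - f x = (y - x) * deriv_on {a..b} f z"
      using mvt_deriv_on[OF assms(1) xy(1,2)] xy(3) by auto
    then have "0 \<le> (y - x) * deriv_on {a..b} f z"
      using xy assms(2) by (intro mult_nonneg_nonneg) auto
    with z show ?thesis by simp
  qed simp
qed

lemma deriv_on_nonpos_imp_antimono_on: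
  assumes "C_on (Suc k) {a..b} f" "\<forall>x\<in>{a..b}. deriv_on {a..b} f x \<le> 0"
  shows "antimono_on {a..b} f"
proof (rule monotone_onI)
  fix x y assume xy: "x \<in> {a..b}" "y \<in> {a..b}" "x \<le> y"
  show "f y \<le> f x"
  proof (cases "x = y")
    case False
    then obtain z where z: "z \<in> {x<..<y}" "f y - f x = (y - x) * deriv_on {a..b} f z"
      using mvt_deriv_on[OF assms(1) xy(1,2)] xy(3) by auto
    then have "(y - x) * deriv_on {a..b} f z \<le> 0"
      using xy assms(2) by (intro mult_nonneg_nonpos) auto
    with z show ?thesis by simp
  qed simp
qed

lemma abs_diff_le_deriv_on_bound:
  assumes "C_on (Suc k) {a..b} f" "\<forall>x\<in>{a..b}. \<bar>deriv_on {a..b} f x\<bar> \<le> B"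
    and xy: "x \<in> {a..b}" "y \<in> {a..b}" "x \<le> y"
  shows "\<bar>f y - f x\<bar> \<le> B * (y - x)"
proof (cases "x = y")
  case False
  then obtain z where z: "z \<in> {x<..<y}" "f y - f x = (y - x) * deriv_on {a..b} f z"
    using mvt_deriv_on[OF assms(1) xy(1,2)] xy(3) by auto
  then have "\<bar>f y - f x\<bar> = (y - x) * \<bar>deriv_on {a..b} f z\<bar>"
    using xy by (simp add: abs_mult)
  also have "\<dots> \<le> (y - x) * B"
    using z xy assms(2) by (intro mult_left_mono) auto
  finally show ?thesis by (simp add: mult.commute)
qed simp

section \<open>From essential suprema to pointwise bounds\<close>

lemma C_on_imp_continuous_on: "C_on k S f \<Longrightarrow> continuous_on S f"
  by (cases k) (auto intro: differentiable_imp_continuous_on)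

text \<open>By continuity the sublevel set is closed, and a closed set containing almost every point
  of an open interval contains all of it. Taking the closure then recovers the end points.\<close>

lemma AE_lebesgue_on_continuous_le:
  fixes f :: "real \<Rightarrow> real"
  assumes "a < b" and f: "continuous_on {a..b} f"
    and AE: "AE x in lebesgue_on {a..b}. f x \<le> c" and "x \<in> {a..b}"
  shows "f x \<le> c"
proof -
  let ?C = "{x \<in> {a..b}. f x \<le> c}"
  have closed: "closed ?C"
    using continuous_on_closed_Collect_le[OF f continuous_on_const closed_atLeastAtMost] .
  have "AE x in lebesgue. x \<in> {a..b} \<longrightarrow> f x \<le> c"
    using AE by (subst (asm) AE_restrict_space_iff) auto
  then have "AE x \<in> {a<..<b} in lebesgue. x \<in> ?C"
    by eventually_elim auto
  then have "{a<..<b} \<subseteq> ?C"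
    using mem_closed_if_AE_lebesgue_open[OF open_greaterThanLessThan closed] by blast
  then have "closure {a<..<b} \<subseteq> ?C"
    using closed by (rule closure_minimal)
  with \<open>x \<in> {a..b}\<close> show ?thesis
    using \<open>a < b\<close> by auto
qed

text \<open>This turns the extended-real CFL condition into a real inequality: compactness bounds
  the norm from above, and continuity upgrades the almost everywhere bound to every point.\<close>

lemma Linf_norm_finite:
  assumes "a < b" and f: "continuous_on {a..b} f"
  obtains c where "Linf_norm {a..b} f = ereal c" "\<forall>x\<in>{a..b}. \<bar>f x\<bar> \<le> c"
proof -
  let ?M = "lebesgue_on {a..b}"
  have cont: "continuous_on {a..b} (\<lambda>x. \<bar>f x\<bar>)"
    by (intro continuous_intros f)
  have meas: "(\<lambda>x. ereal \<bar>f x\<bar>) \<in> borel_measurable ?M"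
    using continuous_imp_measurable_on_sets_lebesgue[OF cont] by simp
  obtain B where B: "\<forall>x\<in>{a..b}. \<bar>f x\<bar> \<le> B"
    using compact_imp_bounded[OF compact_continuous_image[OF cont compact_Icc]]
    by (auto simp: bounded_iff)
  have le: "Linf_norm {a..b} f \<le> ereal B"
    unfolding Linf_norm_def using B by (intro esssup_I meas) (auto intro!: AE_I2)
  have AE: "AE x in ?M. ereal \<bar>f x\<bar> \<le> Linf_norm {a..b} f"
    unfolding Linf_norm_def by (rule esssup_AE)
  have bound: "\<bar>f x\<bar> \<le> c" if "Linf_norm {a..b} f \<le> ereal c" "x \<in> {a..b}" for x c
  proof (rule AE_lebesgue_on_continuous_le[OF \<open>a < b\<close> cont _ that(2)])
    show "AE x in ?M. \<bar>f x\<bar> \<le> c"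
      using AE by eventually_elim (use that(1) in \<open>auto dest: order_trans\<close>)
  qed
  \<comment> \<open>With norm \<open>-\<infinity>\<close>, the constant -1 would bound the absolute
    value of \<open>f a\<close>.\<close>
  have "Linf_norm {a..b} f \<noteq> -\<infinity>"
    using bound[of "-1" a] \<open>a < b\<close> by auto
  with le obtain c where c: "Linf_norm {a..b} f = ereal c"
    by (cases "Linf_norm {a..b} f") auto
  show thesis
    using c bound[of c] by (intro that[of c]) auto
qed

section \<open>Cell integrals of a decreasing kernel\<close>

lemma antimono_on_integral_bounds:
  fixes w :: "real \<Rightarrow> real"
  assumes "antimono_on {a..b} w" "w integrable_on {a..b}" "a \<le> b"
  shows "(b - a) * w b \<le> integral {a..b} w" "integral {a..b} w \<le> (b - a) * w a"
proof -
  have "integral {a..b} (\<lambda>_. w b) \<le> integral {a..b} w"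
    using assms by (intro integral_le) (auto intro: monotone_onD)
  then show "(b - a) * w b \<le> integral {a..b} w"
    using assms by simp
  have "integral {a..b} w \<le> integral {a..b} (\<lambda>_. w a)"
    using assms by (intro integral_le) (auto intro: monotone_onD)
  then show "integral {a..b} w \<le> (b - a) * w a"
    using assms by simp
qed

text \<open>Adjacent cells have the same length \<open>h\<close> and share the node
  \<open>c\<close>, so \<open>h * w c\<close> separates the two integrals.\<close>

lemma weight_antimono:
  assumes "antimono_on {0..real N * h} w" "continuous_on {0..real N * h} w" "h > 0" "Suc k < N"
  shows "weight w h (Suc k) \<le> weight w h k"
proof -
  define c where "c = real (Suc k) * h"
  have sub: "{real k * h..c} \<subseteq> {0..real N * h}" "{c..(real (Suc k) + 1) * h} \<subseteq> {0..real N * h}"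
    unfolding c_def using assms(3,4) by auto
  have len: "c - real k * h = h" "(real (Suc k) + 1) * h - c = h"
    unfolding c_def by (simp_all add: algebra_simps)
  have "weight w h (Suc k) \<le> h * w c"
    using antimono_on_integral_bounds(2)[OF monotone_on_subset[OF assms(1) sub(2)]
        integrable_continuous_interval[OF continuous_on_subset[OF assms(2) sub(2)]]] len assms(3)
    by (simp add: weight_def c_def)
  moreover have "h * w c \<le> weight w h k"
    using antimono_on_integral_bounds(1)[OF monotone_on_subset[OF assms(1) sub(1)]
        integrable_continuous_interval[OF continuous_on_subset[OF assms(2) sub(1)]]] len assms(3)
    by (simp add: weight_def c_def add.commute)
  ultimately show ?thesis by linarith
qed

lemma weight_nonneg:
  assumes "\<forall>x\<in>{0..real N * h}. w x \<ge> 0" "continuous_on {0..real N * h} w" "h > 0" "k < N"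
  shows "weight w h k \<ge> 0"
proof -
  have sub: "{real k * h..(real k + 1) * h} \<subseteq> {0..real N * h}"
    using assms(3,4) by auto
  show ?thesis
    unfolding weight_def
    using assms(1) sub
    by (intro integral_nonneg integrable_continuous_interval continuous_on_subset[OF assms(2)]) auto
qed

lemma sum_weight:
  assumes "continuous_on {0..real N * h} w" "h > 0"
  shows "(\<Sum>k = 0..<N. weight w h k) = integral {0..real N * h} w"
  using assms(1)
proof (induction N)
  case (Suc N)
  have "continuous_on {0..real N * h} w"
    using assms(2) by (intro continuous_on_subset[OF Suc.prems]) auto
  with Suc.IH have "(\<Sum>k = 0..<Suc N. weight w h k)
      = integral {0..real N * h} w + integral {real N * h..real (Suc N) * h} w"
    by (simp add: weight_def add.commute)
  also have "\<dots> = integral {0..real (Suc N) * h} w"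
    using assms(2) Suc.prems
    by (intro Henstock_Kurzweil_Integration.integral_combine integrable_continuous_interval) auto
  finally show ?case .
qed simp

section \<open>Interface velocities and summation by parts\<close>

lemma sum_decreasing_weights_le:
  fixes \<gamma> u :: "nat \<Rightarrow> real"
  assumes "\<And>k. k < n \<Longrightarrow> \<gamma> (Suc k) \<le> \<gamma> k" "\<And>k. c \<le> u k"
  shows "(\<Sum>k = 0..<Suc n. \<gamma> k * (u k - u (Suc k))) \<le> \<gamma> 0 * (u 0 - c) - \<gamma> n * (u (Suc n) - c)"
  using assms(1)
proof (induction n)
  case (Suc n)
  \<comment> \<open>This product is exactly the slack gained from \<open>n\<close> to
    \<open>Suc n\<close>; keeping the boundary term \<open>\<gamma> n * (u (Suc n) - c)\<close> in
    the claim is what makes the induction close.\<close>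
  have "0 \<le> (\<gamma> n - \<gamma> (Suc n)) * (u (Suc n) - c)"
    using Suc.prems[of n] assms(2) by (intro mult_nonneg_nonneg) auto
  with Suc show ?case by (simp add: algebra_simps)
qed (simp add: algebra_simps)

lemma velocity_diff:
  "velocity N \<gamma> v r (j - 1) - velocity N \<gamma> v r j
    = (\<Sum>k = 0..<N. \<gamma> k * (v (r (j + int k)) - v (r (j + int (Suc k)))))"
  by (simp add: velocity_def sum_subtractf right_diff_distrib algebra_simps)

lemma velocity_diff_le:
  assumes "\<And>k. Suc k < N \<Longrightarrow> \<gamma> (Suc k) \<le> \<gamma> k" "\<And>k. k < N \<Longrightarrow> 0 \<le> \<gamma> k" "N \<ge> 1"
    and "\<And>i. c \<le> v (r i)"
  shows "velocity N \<gamma> v r (j - 1) - velocity N \<gamma> v r j \<le> \<gamma> 0 * (v (r j) - c)"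
proof -
  obtain n where N: "N = Suc n" using assms(3) by (cases N) auto
  have "0 \<le> \<gamma> n * (v (r (j + int (Suc n))) - c)"
    using assms(2)[of n] assms(4) N by (intro mult_nonneg_nonneg) auto
  then show ?thesis
    using sum_decreasing_weights_le[of n \<gamma> c "\<lambda>k. v (r (j + int k))"] assms(1,4)
    unfolding velocity_diff N by simp
qed

lemma velocity_diff_ge:
  assumes "\<And>k. Suc k < N \<Longrightarrow> \<gamma> (Suc k) \<le> \<gamma> k" "\<And>k. k < N \<Longrightarrow> 0 \<le> \<gamma> k" "N \<ge> 1"
    and "\<And>i. v (r i) \<le> c"
  shows "\<gamma> 0 * (v (r j) - c) \<le> velocity N \<gamma> v r (j - 1) - velocity N \<gamma> v r j"
  \<comment> \<open>\<open>velocity\<close> is linear in \<open>v\<close>, so replacing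
    \<open>v\<close> and \<open>c\<close> by their negatives reverses the inequality.\<close>
  using velocity_diff_le[of N \<gamma> "- c" "\<lambda>x. - v x" r j] assms
  by (simp add: velocity_def sum_negf algebra_simps)

lemma velocity_nonneg:
  assumes "\<And>k. k < N \<Longrightarrow> 0 \<le> \<gamma> k" "\<And>i. 0 \<le> v (r i)"
  shows "0 \<le> velocity N \<gamma> v r j"
  unfolding velocity_def using assms by (intro sum_nonneg mult_nonneg_nonneg) auto

text \<open>Total weight at most 1 is what allows the CFL condition to carry the norm of
  \<open>v\<close> without a factor for the mass of the kernel.\<close>

lemma velocity_le:
  assumes "\<And>k. k < N \<Longrightarrow> 0 \<le> \<gamma> k" "\<And>i. v (r i) \<le> B" "0 \<le> B" "(\<Sum>k = 0..<N. \<gamma> k) \<le> 1"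
  shows "velocity N \<gamma> v r j \<le> B"
proof -
  have "velocity N \<gamma> v r j \<le> (\<Sum>k = 0..<N. \<gamma> k * B)"
    unfolding velocity_def using assms by (intro sum_mono mult_left_mono) auto
  also have "\<dots> = (\<Sum>k = 0..<N. \<gamma> k) * B"
    by (simp add: sum_distrib_right)
  also have "\<dots> \<le> 1 * B"
    using assms by (intro mult_right_mono)
  finally show ?thesis by simp
qed

section \<open>Invariance of an interval under one step\<close>

text \<open>The gap \<open>d\<close> is \<open>M - r j\<close> for the upper bound and \<open>r j - m\<close> for the lower one.\<close>

lemma flux_difference_le:
  fixes a V D g0 e :: real
  assumes "D \<le> \<gamma>0 * A * d" "0 \<le> g0" "g0 \<le> G" "0 \<le> V" "V \<le> B" "e \<le> C * d"
    and "0 \<le> \<gamma>0" "0 \<le> A" "0 \<le> C" "0 \<le> d" "0 \<le> lam" "lam * (\<gamma>0 * A * G + B * C) \<le> 1"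
  shows "lam * (D * g0 + V * e) \<le> d"
proof -
  \<comment> \<open>\<open>D\<close> may be negative, so it is replaced by its nonnegative bound
    before \<open>g0\<close> is enlarged to \<open>G\<close>; likewise \<open>e\<close> before
    \<open>V\<close>.\<close>
  have "D * g0 \<le> (\<gamma>0 * A * d) * g0"
    using assms by (intro mult_right_mono)
  also have "\<dots> \<le> (\<gamma>0 * A * d) * G"
    using assms by (intro mult_left_mono mult_nonneg_nonneg)
  finally have 1: "D * g0 \<le> (\<gamma>0 * A * d) * G" .
  have "V * e \<le> V * (C * d)"
    using assms by (intro mult_left_mono)
  also have "\<dots> \<le> B * (C * d)"
    using assms by (intro mult_right_mono mult_nonneg_nonneg)
  finally have "D * g0 + V * e \<le> (\<gamma>0 * A * G + B * C) * d"
    using 1 by (simp add: algebra_simps)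
  then have "lam * (D * g0 + V * e) \<le> (lam * (\<gamma>0 * A * G + B * C)) * d"
    using mult_left_mono[OF _ \<open>0 \<le> lam\<close>] by (metis mult.assoc)
  also have "\<dots> \<le> 1 * d"
    using assms by (intro mult_right_mono)
  finally show ?thesis by simp
qed

lemma godunov_step_bounds:
  fixes lam m M A B C G :: real and r :: "int \<Rightarrow> real"
    and g v :: "real \<Rightarrow> real" and \<gamma> :: "nat \<Rightarrow> real" and N :: nat
  defines "V \<equiv> velocity N \<gamma> v r"
  assumes \<gamma>: "\<And>k. Suc k < N \<Longrightarrow> \<gamma> (Suc k) \<le> \<gamma> k" "\<And>k. k < N \<Longrightarrow> 0 \<le> \<gamma> k"
      "(\<Sum>k = 0..<N. \<gamma> k) \<le> 1" "N \<ge> 1"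
    and g: "mono_on {m..M} g" "\<forall>x\<in>{m..M}. 0 \<le> g x \<and> g x \<le> G"
      "\<And>x y. \<lbrakk>x \<in> {m..M}; y \<in> {m..M}; x \<le> y\<rbrakk> \<Longrightarrow> g y - g x \<le> C * (y - x)"
    and v: "antimono_on {m..M} v" "\<forall>x\<in>{m..M}. 0 \<le> v x \<and> v x \<le> B"
      "\<And>x y. \<lbrakk>x \<in> {m..M}; y \<in> {m..M}; x \<le> y\<rbrakk> \<Longrightarrow> v x - v y \<le> A * (y - x)"
    and ABC: "0 \<le> A" "0 \<le> C"
    and lam: "0 \<le> lam" "lam * (\<gamma> 0 * A * G + B * C) \<le> 1"
    and r: "\<And>i. r i \<in> {m..M}"
  shows "r j - lam * (V j * g (r j) - V (j - 1) * g (r (j - 1))) \<in> {m..M}"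
proof -
  have mM: "m \<in> {m..M}" "M \<in> {m..M}"
    using r[of 0] by auto
  have \<gamma>0: "0 \<le> \<gamma> 0"
    using \<gamma>(2)[of 0] \<gamma>(4) by simp
  have Vpos: "0 \<le> V i" for i
    unfolding V_def using v(2) r by (intro velocity_nonneg \<gamma>) auto
  have "0 \<le> B" using v(2) mM by force
  then have VB: "V i \<le> B" for i
    unfolding V_def using v(2) r \<gamma> by (intro velocity_le) auto
  \<comment> \<open>As \<open>v\<close> decreases, \<open>v M\<close> is its least value on
    \<open>{m..M}\<close>; for the reverse difference below, \<open>v m\<close> is the
    greatest.\<close>
  have "V (j - 1) - V j \<le> \<gamma> 0 * (v (r j) - v M)"
    unfolding V_def using r mM by (intro velocity_diff_le \<gamma> monotone_onD[OF v(1)]) auto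
  also have "\<dots> \<le> \<gamma> 0 * A * (M - r j)"
    using v(3)[of "r j" M] r[of j] mM \<gamma>0 by (simp add: mult.assoc mult_left_mono)
  finally have up: "V (j - 1) - V j \<le> \<gamma> 0 * A * (M - r j)" .
  have "V j - V (j - 1) \<le> \<gamma> 0 * (v m - v (r j))"
    using velocity_diff_ge[of N \<gamma> v r "v m" j, OF \<gamma>(1,2,4)] r mM monotone_onD[OF v(1)]
    unfolding V_def by (force simp: right_diff_distrib)
  also have "\<dots> \<le> \<gamma> 0 * A * (r j - m)"
    using v(3)[of m "r j"] r[of j] mM \<gamma>0 by (simp add: mult.assoc mult_left_mono)
  finally have lo: "V j - V (j - 1) \<le> \<gamma> 0 * A * (r j - m)" .

  \<comment> \<open>With \<open>g M\<close> in place of the upstream value, the flux difference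
    splits into two terms, each bounded by a multiple of the gap \<open>M - r j\<close>.\<close>
  have "V (j - 1) * g (r (j - 1)) - V j * g (r j) \<le> V (j - 1) * g M - V j * g (r j)"
    using Vpos r[of "j - 1"] mM monotone_onD[OF g(1)] by (auto intro!: mult_left_mono)
  also have "\<dots> = (V (j - 1) - V j) * g M + V j * (g M - g (r j))"
    by (simp add: algebra_simps)
  finally have "lam * (V (j - 1) * g (r (j - 1)) - V j * g (r j))
      \<le> lam * ((V (j - 1) - V j) * g M + V j * (g M - g (r j)))"
    using lam(1) by (rule mult_left_mono)
  also have "\<dots> \<le> M - r j"
    by (rule flux_difference_le[OF up _ _ Vpos VB g(3) \<gamma>0 ABC _ lam]) (use g(2) r[of j] mM in auto)
  finally have upper: "r j - lam * (V j * g (r j) - V (j - 1) * g (r (j - 1))) \<le> M"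
    by (simp add: algebra_simps)

  \<comment> \<open>The mirror image: the upstream value is lowered to \<open>g m\<close>, and the
    gap is \<open>r j - m\<close>.\<close>
  have "V j * g (r j) - V (j - 1) * g (r (j - 1)) \<le> V j * g (r j) - V (j - 1) * g m"
    using Vpos r[of "j - 1"] mM monotone_onD[OF g(1)] by (auto intro!: mult_left_mono)
  also have "\<dots> = (V j - V (j - 1)) * g m + V j * (g (r j) - g m)"
    by (simp add: algebra_simps)
  finally have "lam * (V j * g (r j) - V (j - 1) * g (r (j - 1)))
      \<le> lam * ((V j - V (j - 1)) * g m + V j * (g (r j) - g m))"
    using lam(1) by (rule mult_left_mono)
  also have "\<dots> \<le> r j - m"
    by (rule flux_difference_le[OF lo _ _ Vpos VB g(3) \<gamma>0 ABC _ lam]) (use g(2) r[of j] mM in auto)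
  finally show ?thesis
    using upper by simp
qed

section \<open>Invariance for all time steps\<close>

theorem theorem3p3:
  fixes \<rho>max W0 \<eta> h \<tau> lam :: real
    and I :: "real set"
    and g v :: "real \<Rightarrow> real"
    and w :: "real \<Rightarrow> real \<Rightarrow> real"
    and N :: nat
    and \<gamma> :: "nat \<Rightarrow> real"
    and \<rho>0 :: "int \<Rightarrow> real"
    and \<rho> :: "nat \<Rightarrow> int \<Rightarrow> real"
    and \<rho>M \<rho>m :: real
  assumes "\<rho>max > 0" and "I = {0..\<rho>max}"
    and "C_on 1 I g" and "\<forall>x\<in>I. g x \<ge> 0" and "\<forall>x\<in>I. deriv_on I g x \<ge> 0"
    and "C_on 2 I v" and "\<forall>x\<in>I. v x \<ge> 0" and "\<forall>x\<in>I. deriv_on I v x \<le> 0"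
    and "\<forall>e>0. C_on 1 {0..e} (w e)
           \<and> (\<forall>x\<in>{0..e}. w e x \<ge> 0)
           \<and> (\<forall>x\<in>{0..e}. deriv_on {0..e} (w e) x \<le> 0)
           \<and> integral {0..e} (w e) = W0"
    and "((\<lambda>e. w e 0) \<longlongrightarrow> 0) at_top"
    and "W0 \<le> 1"
    and "\<eta> > 0" and "h > 0" and "N \<ge> 1" and "\<eta> = real N * h"
    and "\<tau> > 0" and "lam = \<tau> / h"
    and "\<gamma> = weight (w \<eta>) h"
    and "\<forall>j. \<rho>0 j \<in> I"
    and "\<rho>M = (SUP j. \<rho>0 j)" and "\<rho>m = (INF j. \<rho>0 j)"
    and "\<rho> = godunov lam N \<gamma> v g \<rho>0"
    and CFL: "ereal lam \<le> 1 / (ereal (\<gamma> 0) * Linf_norm I (deriv_on I v) * Linf_norm I g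
                 + Linf_norm I v * Linf_norm I (deriv_on I g))"
  shows "\<forall>j n. \<rho>m \<le> \<rho> n j \<and> \<rho> n j \<le> \<rho>M"
proof -
  have I: "I = {0..\<rho>max}" by fact
  have g1: "C_on (Suc 0) {0..\<rho>max} g" and v1: "C_on (Suc (Suc 0)) {0..\<rho>max} v"
    using assms by (simp_all add: numeral_2_eq_2)
  obtain A where A: "Linf_norm I (deriv_on I v) = ereal A" "\<forall>x\<in>I. \<bar>deriv_on I v x\<bar> \<le> A"
    using Linf_norm_finite[of 0 \<rho>max "deriv_on I v"] C_on_imp_continuous_on[of "Suc 0"] v1 assms(1) I
    by auto
  obtain B where B: "Linf_norm I v = ereal B" "\<forall>x\<in>I. \<bar>v x\<bar> \<le> B"
    using Linf_norm_finite[of 0 \<rho>max v] C_on_imp_continuous_on[OF v1] assms(1) I by auto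
  obtain C where C: "Linf_norm I (deriv_on I g) = ereal C" "\<forall>x\<in>I. \<bar>deriv_on I g x\<bar> \<le> C"
    using Linf_norm_finite[of 0 \<rho>max "deriv_on I g"] g1 assms(1) I by auto
  obtain G where G: "Linf_norm I g = ereal G" "\<forall>x\<in>I. \<bar>g x\<bar> \<le> G"
    using Linf_norm_finite[of 0 \<rho>max g] C_on_imp_continuous_on[OF g1] assms(1) I by auto
  have "0 \<in> I" using I assms(1) by simp
  then have nonneg: "0 \<le> A" "0 \<le> B" "0 \<le> C" "0 \<le> G"
    using A(2) B(2) C(2) G(2) by (meson abs_ge_zero order_trans)+

  \<comment> \<open>The kernel family is used at \<open>\<eta> = N * h\<close>; the bound on the
    integral comes from \<open>W0 \<le> 1\<close>.\<close>
  have w: "C_on (Suc 0) {0..real N * h} (w \<eta>)" "\<forall>x\<in>{0..real N * h}. w \<eta> x \<ge> 0"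
      "\<forall>x\<in>{0..real N * h}. deriv_on {0..real N * h} (w \<eta>) x \<le> 0"
      "integral {0..real N * h} (w \<eta>) \<le> 1"
    using assms by auto
  note wc = C_on_imp_continuous_on[OF w(1)]
  have \<gamma>: "\<And>k. Suc k < N \<Longrightarrow> \<gamma> (Suc k) \<le> \<gamma> k" "\<And>k. k < N \<Longrightarrow> 0 \<le> \<gamma> k"
      "(\<Sum>k = 0..<N. \<gamma> k) \<le> 1"
    using weight_antimono[OF deriv_on_nonpos_imp_antimono_on[OF w(1,3)] wc \<open>h > 0\<close>]
      weight_nonneg[OF w(2) wc \<open>h > 0\<close>] sum_weight[OF wc \<open>h > 0\<close>] w(4) assms
    by auto

  have lam: "0 \<le> lam" using assms by simp
  define D where "D = \<gamma> 0 * A * G + B * C"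
  have "0 \<le> D"
    unfolding D_def using nonneg \<gamma>(2)[of 0] \<open>N \<ge> 1\<close> by simp
  have "ereal lam \<le> 1 / ereal D"
    using CFL unfolding A(1) B(1) C(1) G(1) D_def by simp
  \<comment> \<open>If \<open>D = 0\<close>, the extended-real quotient is infinite and leaves
    \<open>lam\<close> unrestricted, but then \<open>lam * D = 0\<close>.\<close>
  then have cfl: "lam * D \<le> 1"
    using \<open>0 \<le> D\<close> by (cases "D = 0") (auto simp: one_ereal_def pos_le_divide_eq)

  \<comment> \<open>Boundedness is needed for the real-valued \<open>SUP\<close> and
    \<open>INF\<close> to be the true supremum and infimum.\<close>
  have bdd: "bdd_above (range \<rho>0)" "bdd_below (range \<rho>0)"
    using \<open>\<forall>j. \<rho>0 j \<in> I\<close> I by (auto simp: bdd_above_def bdd_below_def)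
  have init: "\<rho>0 j \<in> {\<rho>m..\<rho>M}" for j
    using bdd assms by (auto intro: cSUP_upper cINF_lower)
  have "0 \<le> \<rho>m" "\<rho>M \<le> \<rho>max"
    using \<open>\<forall>j. \<rho>0 j \<in> I\<close> I assms by (auto intro: cINF_greatest cSUP_least)
  then have sub: "{\<rho>m..\<rho>M} \<subseteq> {0..\<rho>max}" by auto
  have gm: "mono_on {\<rho>m..\<rho>M} g" and va: "antimono_on {\<rho>m..\<rho>M} v"
    using deriv_on_nonneg_imp_mono_on[OF g1] deriv_on_nonpos_imp_antimono_on[OF v1] assms I
      monotone_on_subset[OF _ sub] by auto
  have gL: "g y - g x \<le> C * (y - x)" and vL: "v x - v y \<le> A * (y - x)"
    if "x \<in> {\<rho>m..\<rho>M}" "y \<in> {\<rho>m..\<rho>M}" "x \<le> y" for x y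
    using abs_diff_le_deriv_on_bound[OF g1, of C x y] abs_diff_le_deriv_on_bound[OF v1, of A x y]
      that sub A(2) C(2) I by auto
  have gB: "\<forall>x\<in>{\<rho>m..\<rho>M}. 0 \<le> g x \<and> g x \<le> G" and vB: "\<forall>x\<in>{\<rho>m..\<rho>M}. 0 \<le> v x \<and> v x \<le> B"
    using sub G(2) B(2) assms I by (auto dest!: subsetD)

  \<comment> \<open>The invariant interval is \<open>{\<rho>m..\<rho>M}\<close>, while
    \<open>A\<close>, \<open>B\<close>, \<open>C\<close>, \<open>G\<close> are bounds on all of
    \<open>I\<close>. The index \<open>j\<close> is generalized because a step reads neighbouring
    cells.\<close>
  have "\<rho> n j \<in> {\<rho>m..\<rho>M}" for n j
  proof (induction n arbitrary: j)
    case 0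
    then show ?case using init \<open>\<rho> = godunov lam N \<gamma> v g \<rho>0\<close> by simp
  next
    case (Suc n)
    show ?case
      using godunov_step_bounds[OF \<gamma> \<open>N \<ge> 1\<close> gm gB gL va vB vL nonneg(1,3) lam cfl[unfolded D_def] Suc]
        \<open>\<rho> = godunov lam N \<gamma> v g \<rho>0\<close>
      by (simp add: Let_def)
  qed
  then show ?thesis by auto
qed

end
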